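(* Let $A$ be a $\mathbb{Z}$-graded associative algebra over a field $\mathbb{K}$ of characteristic zero, with multiplication $\gamma_2 : A^{\otimes 2} \to A$ and a degree $+1$ linear operator $\Delta : A \to A$ with $\Delta^2 = 0$. Suppose that $\Delta$ has associative order $2$. Let $m_2 = \Delta(\gamma_2) - \gamma_2(\Delta \otimes id) - \gamma_2(id \otimes \Delta)$. Then the following identities of maps $A^{\otimes 3} \to A$ hold: $$\gamma_2(id \otimes m_2) = m_2(\gamma_2 \otimes id) \qquad \text{and} \qquad \gamma_2(m_2 \otimes id) = m_2(id \otimes \gamma_2).$$
   Context: No compatibility between $\Delta$ and the multiplication is assumed a priori. Denote by $\gamma_n : A^{\otimes n} \to A$ the multiplication of $n$ ordered elements (so $\gamma_1 = id$). Define $m_1 = \Delta$, $m_2 = \Delta(\gamma_2) - \gamma_2(\Delta \otimes id) - \gamma_2(id \otimes \Delta)$, and for $n \geq 3$ $$m_n = \Delta(\gamma_n) - \gamma_2(\Delta(\gamma_{n-1}) \otimes id) - \gamma_2(id \otimes \Delta(\gamma_{n-1})) + \gamma_3(id \otimes \Delta(\gamma_{n-2}) \otimes id).$$ All expressions are composites of maps. Definition: $\Delta$ has associative order $n$ if $m_{n+1} = 0$. In particular, associative order $2$ means $m_3 = 0$. Koszul sign rule: for homogeneous maps $f,g$ and homogeneous elements $x,y$, $(f \otimes g)(x \otimes y) = (-1)^{|g||x|} f(x) \otimes g(y)$. Degrees are those of $A$. *)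

theory Defs
  imports Complex_Main
begin

section \<open>Graded associative algebras\<close>

definition homogeneous_decomposition :: "(int \<Rightarrow> 'a::ab_group_add set) \<Rightarrow> 'a \<Rightarrow> (int \<Rightarrow> 'a) \<Rightarrow> bool"
  where "homogeneous_decomposition gr x f \<longleftrightarrow>
    finite {i. f i \<noteq> 0} \<and> (\<forall>i. f i \<in> gr i) \<and> x = (\<Sum>i | f i \<noteq> 0. f i)"

text \<open>The multiplication is that of the (not necessarily unital) associative ring \<open>'a\<close>;
  the whole type is the direct sum of the subspaces \<open>gr i\<close>.\<close>

locale graded_algebra = vector_space scale
  for scale :: "'k::field_char_0 \<Rightarrow> 'a::ring \<Rightarrow> 'a" +
  fixes gr :: "int \<Rightarrow> 'a set"
  assumes scale_mult_left: "scale c x * y = scale c (x * y)"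
    and scale_mult_right: "x * scale c y = scale c (x * y)"
    and subspace_gr: "subspace (gr i)"
    and direct_sum: "\<exists>!f. homogeneous_decomposition gr x f"
    and mult_gr: "x \<in> gr i \<Longrightarrow> y \<in> gr j \<Longrightarrow> x * y \<in> gr (i + j)"

definition hcomponent :: "(int \<Rightarrow> 'a::ab_group_add set) \<Rightarrow> 'a \<Rightarrow> int \<Rightarrow> 'a"
  where "hcomponent gr x = (THE f. homogeneous_decomposition gr x f)"

text \<open>The linear extension to all of \<open>A\<close> of \<open>x \<mapsto> (-1)\<^bsup>d|x|\<^esup> x\<close> for homogeneous \<open>x\<close>.\<close>

definition koszul_sign ::
    "('k::field \<Rightarrow> 'a::ab_group_add \<Rightarrow> 'a) \<Rightarrow> (int \<Rightarrow> 'a set) \<Rightarrow> int \<Rightarrow> 'a \<Rightarrow> 'a"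
  where "koszul_sign scale gr d x =
    (\<Sum>i | hcomponent gr x i \<noteq> 0. scale ((-1) powi (d * i)) (hcomponent gr x i))"

lemma (in graded_algebra) koszul_sign_homogeneous:
  assumes "x \<in> gr i"
  shows "koszul_sign scale gr d x = scale ((-1) powi (d * i)) x"
proof -
  have "0 \<in> gr j" for j
    using subspace_gr subspace_0 by blast
  then have "homogeneous_decomposition gr x (\<lambda>j. if j = i then x else 0)"
    using assms by (cases "x = 0") (auto simp: homogeneous_decomposition_def)
  then have "hcomponent gr x = (\<lambda>j. if j = i then x else 0)"
    unfolding hcomponent_def using direct_sum[of x] by (simp add: the1_equality)
  then show ?thesis
    by (cases "x = 0") (auto simp: koszul_sign_def)
qed

section \<open>Maps on tensor powers and their composites\<close>

text \<open>A linear map \<open>A\<^sup>\<otimes>\<^sup>n \<rightarrow> A\<close> of degree \<open>d\<close> is given by the corresponding multilinear map, as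
  \<open>Multimap n d f\<close>: \<open>f [x1, \<dots>, xn]\<close> is its value at \<open>x1 \<otimes> \<dots> \<otimes> xn\<close>. Only the values of \<open>f\<close> at lists
  of length \<open>n\<close> are meaningful.\<close>

datatype 'a multimap = Multimap (arity: nat) (deg: int) (app: "'a list \<Rightarrow> 'a")

text \<open>The factors of \<open>(f1 \<otimes> \<dots> \<otimes> fk) (x1 \<otimes> \<dots> \<otimes> xn)\<close>. The Koszul rule is applied in the form
  \<open>(f \<otimes> g) (x \<otimes> y) = (-1)\<^bsup>|g||x|\<^esup> f x \<otimes> g y\<close> with \<open>g = f2 \<otimes> \<dots> \<otimes> fk\<close>, of degree \<open>|f2| + \<dots> + |fk|\<close>.
  As \<open>|x|\<close> is the sum of the degrees of the entries of \<open>x\<close>, the sign is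
  distributed over these entries.\<close>

fun tensor_app ::
    "('k::field \<Rightarrow> 'a::ab_group_add \<Rightarrow> 'a) \<Rightarrow> (int \<Rightarrow> 'a set) \<Rightarrow> 'a multimap list \<Rightarrow> 'a list \<Rightarrow> 'a list"
  where
    "tensor_app scale gr [] xs = []"
  | "tensor_app scale gr (f # fs) xs =
      app f (map (koszul_sign scale gr (sum_list (map deg fs))) (take (arity f) xs))
        # tensor_app scale gr fs (drop (arity f) xs)"

text \<open>\<open>compose scale gr h [f1, \<dots>, fk]\<close> is \<open>h \<circ> (f1 \<otimes> \<dots> \<otimes> fk)\<close>, for \<open>h\<close> of arity \<open>k\<close>.\<close>

definition compose ::
    "('k::field \<Rightarrow> 'a::ab_group_add \<Rightarrow> 'a) \<Rightarrow> (int \<Rightarrow> 'a set) \<Rightarrow>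
      'a multimap \<Rightarrow> 'a multimap list \<Rightarrow> 'a multimap"
  where "compose scale gr h fs =
    Multimap (sum_list (map arity fs)) (deg h + sum_list (map deg fs))
      (\<lambda>xs. app h (tensor_app scale gr fs xs))"

definition id_map :: "'a multimap"
  where "id_map = Multimap 1 0 hd"

definition op_map :: "('a \<Rightarrow> 'a) \<Rightarrow> 'a multimap"
  where "op_map \<Delta> = Multimap 1 1 (\<lambda>xs. \<Delta> (hd xs))"

fun ordered_product :: "'a::ring list \<Rightarrow> 'a"
  where
    "ordered_product [] = 0" \<comment> \<open>never used: there is no unit\<close>
  | "ordered_product [x] = x"
  | "ordered_product (x # y # ys) = x * ordered_product (y # ys)"

definition gam :: "nat \<Rightarrow> 'a::ring multimap"
  where "gam n = Multimap n 0 ordered_product"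

section \<open>Associative order\<close>

text \<open>The maps \<open>m\<^sub>n\<close>, for \<open>n \<ge> 1\<close>; the value at \<open>n = 0\<close> is irrelevant.\<close>

definition m_map ::
    "('k::field \<Rightarrow> 'a::ring \<Rightarrow> 'a) \<Rightarrow> (int \<Rightarrow> 'a set) \<Rightarrow> ('a \<Rightarrow> 'a) \<Rightarrow> nat \<Rightarrow> 'a multimap"
  where "m_map scale gr \<Delta> n =
    (let D = op_map \<Delta>; comp = compose scale gr in
     if n = 1 then D
     else if n = 2 then
       Multimap 2 1 (\<lambda>xs.
           app (comp D [gam 2]) xs
         - app (comp (gam 2) [D, id_map]) xs
         - app (comp (gam 2) [id_map, D]) xs)
     else
       Multimap n 1 (\<lambda>xs.
           app (comp D [gam n]) xs
         - app (comp (gam 2) [comp D [gam (n - 1)], id_map]) xs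
         - app (comp (gam 2) [id_map, comp D [gam (n - 1)]]) xs
         + app (comp (gam 3) [id_map, comp D [gam (n - 2)], id_map]) xs))"

definition associative_order ::
    "('k::field \<Rightarrow> 'a::ring \<Rightarrow> 'a) \<Rightarrow> (int \<Rightarrow> 'a set) \<Rightarrow> ('a \<Rightarrow> 'a) \<Rightarrow> nat \<Rightarrow> bool"
  where "associative_order scale gr \<Delta> n \<longleftrightarrow>
    (\<forall>xs. length xs = n + 1 \<longrightarrow> app (m_map scale gr \<Delta> (n + 1)) xs = 0)"

end

theory Submission
  imports Defs
begin

text \<open>Write \<open>\<sigma>\<close> for the sign operator \<open>x \<mapsto> (-1)\<^bsup>|x|\<^esup> x\<close>. Evaluated on elements, the maps are
  \<open>m\<^sub>2(a, b) = \<Delta>(ab) - \<Delta>(a) b - \<sigma>(a) \<Delta>(b)\<close> and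
  \<open>m\<^sub>3(a, b, c) = \<Delta>(abc) - \<Delta>(ab) c - \<sigma>(a) \<Delta>(bc) + \<sigma>(a) \<Delta>(b) c\<close>.
  In each identity, one term of either side cancels in the difference, and the remaining four terms
  make up \<open>m\<^sub>3\<close>:
  \<open>m\<^sub>2(ab, c) - \<sigma>(a) m\<^sub>2(b, c) = m\<^sub>3(a, b, c)\<close> and
  \<open>m\<^sub>2(a, bc) - m\<^sub>2(a, b) c = m\<^sub>3(a, b, c)\<close>.
  In the second line the cancelling terms are both \<open>\<Delta>(a) b c\<close>. In the first line they are
  \<open>\<sigma>(ab) \<Delta>(c)\<close> and \<open>\<sigma>(a) \<sigma>(b) \<Delta>(c)\<close>, so this identity rests on \<open>\<sigma>\<close> being an algebra
  endomorphism (lemma \<open>koszul_sign_mult\<close>), which expresses that degrees add up in products.\<close>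

context graded_algebra
begin

lemma homogeneous_decomposition_hcomponent:
  "homogeneous_decomposition gr x (hcomponent gr x)"
  unfolding hcomponent_def using direct_sum[of x] by (rule theI')

lemma zero_in_gr: "0 \<in> gr i"
  using subspace_gr subspace_0 by blast

lemma hcomponent_in_gr: "hcomponent gr x i \<in> gr i"
  using homogeneous_decomposition_hcomponent[of x] by (simp add: homogeneous_decomposition_def)

lemma finite_hcomponent_support: "finite {i. hcomponent gr x i \<noteq> 0}"
  using homogeneous_decomposition_hcomponent[of x] by (simp add: homogeneous_decomposition_def)

lemma sum_hcomponent:
  assumes "finite S" and "{i. hcomponent gr x i \<noteq> 0} \<subseteq> S"
  shows "(\<Sum>i\<in>S. hcomponent gr x i) = x"
proof -
  have "(\<Sum>i\<in>S. hcomponent gr x i) = (\<Sum>i | hcomponent gr x i \<noteq> 0. hcomponent gr x i)"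
    using assms by (intro sum.mono_neutral_right) auto
  then show ?thesis
    using homogeneous_decomposition_hcomponent[of x] by (simp add: homogeneous_decomposition_def)
qed

text \<open>By uniqueness of the homogeneous decomposition, the sign operator may be computed from any
  expression of \<open>x\<close> as a sum of elements of pairwise distinct degrees, including zero summands.\<close>

lemma koszul_sign_sum_homogeneous:
  assumes "finite S" and f: "\<And>i. i \<in> S \<Longrightarrow> f i \<in> gr i"
  shows "koszul_sign scale gr d (\<Sum>i\<in>S. f i) = (\<Sum>i\<in>S. scale ((-1) powi (d * i)) (f i))"
proof -
  define g where "g i = (if i \<in> S then f i else 0)" for i
  have supp: "{i. g i \<noteq> 0} \<subseteq> S"
    by (auto simp: g_def)
  have "(\<Sum>i | g i \<noteq> 0. g i) = (\<Sum>i\<in>S. f i)"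
    using \<open>finite S\<close> supp by (intro sum.mono_neutral_cong_left) (auto simp: g_def)
  then have "homogeneous_decomposition gr (\<Sum>i\<in>S. f i) g"
    using f zero_in_gr finite_subset[OF supp \<open>finite S\<close>]
    by (auto simp: homogeneous_decomposition_def g_def)
  then have "hcomponent gr (\<Sum>i\<in>S. f i) = g"
    using direct_sum homogeneous_decomposition_hcomponent by blast
  moreover have "(\<Sum>i | g i \<noteq> 0. scale ((-1) powi (d * i)) (g i))
      = (\<Sum>i\<in>S. scale ((-1) powi (d * i)) (f i))"
    using \<open>finite S\<close> supp by (intro sum.mono_neutral_cong_left) (auto simp: g_def)
  ultimately show ?thesis
    by (simp add: koszul_sign_def)
qed

lemma koszul_sign_add:
  "koszul_sign scale gr d (x + y) = koszul_sign scale gr d x + koszul_sign scale gr d y"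
proof -
  let ?x = "hcomponent gr x" and ?y = "hcomponent gr y"
  \<comment> \<open>A common index set turns the three signed sums into sums over the same degrees.\<close>
  let ?S = "{i. ?x i \<noteq> 0} \<union> {i. ?y i \<noteq> 0}"
  have fin: "finite ?S"
    by (simp add: finite_hcomponent_support)
  have x: "(\<Sum>i\<in>?S. ?x i) = x" and y: "(\<Sum>i\<in>?S. ?y i) = y"
    using fin by (auto intro: sum_hcomponent)
  have "x + y = (\<Sum>i\<in>?S. ?x i + ?y i)"
    by (simp only: sum.distrib x y)
  moreover have "?x i + ?y i \<in> gr i" for i
    by (intro subspace_add subspace_gr hcomponent_in_gr)
  ultimately have "koszul_sign scale gr d (x + y)
      = (\<Sum>i\<in>?S. scale ((-1) powi (d * i)) (?x i + ?y i))"
    using koszul_sign_sum_homogeneous[OF fin, of "\<lambda>i. ?x i + ?y i" d] by simp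
  also have "\<dots> = (\<Sum>i\<in>?S. scale ((-1) powi (d * i)) (?x i))
      + (\<Sum>i\<in>?S. scale ((-1) powi (d * i)) (?y i))"
    by (simp only: scale_right_distrib sum.distrib)
  also have "\<dots> = koszul_sign scale gr d x + koszul_sign scale gr d y"
    using koszul_sign_sum_homogeneous[OF fin, of ?x d] koszul_sign_sum_homogeneous[OF fin, of ?y d]
    by (simp only: x y hcomponent_in_gr)
  finally show ?thesis .
qed

lemma koszul_sign_sum:
  "koszul_sign scale gr d (\<Sum>i\<in>S. f i) = (\<Sum>i\<in>S. koszul_sign scale gr d (f i))"
proof -
  have "koszul_sign scale gr d 0 = 0"
    using koszul_sign_add[of d 0 0] by simp
  then show ?thesis
    by (induction S rule: infinite_finite_induct) (simp_all add: koszul_sign_add)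
qed

text \<open>By additivity this reduces to homogeneous factors, where it is
  \<open>(-1)\<^bsup>d(i + j)\<^esup> = (-1)\<^bsup>di\<^esup> (-1)\<^bsup>dj\<^esup>\<close>.\<close>

lemma koszul_sign_mult:
  "koszul_sign scale gr d (x * y) = koszul_sign scale gr d x * koszul_sign scale gr d y"
proof -
  let ?x = "hcomponent gr x" and ?y = "hcomponent gr y"
  let ?S = "{i. ?x i \<noteq> 0}" and ?T = "{i. ?y i \<noteq> 0}"
  have "koszul_sign scale gr d (?x i * ?y j)
      = scale ((-1) powi (d * i)) (?x i) * scale ((-1) powi (d * j)) (?y j)" for i j
    using koszul_sign_homogeneous[OF mult_gr[OF hcomponent_in_gr[of x i] hcomponent_in_gr[of y j]], of d]
    by (simp add: scale_mult_left scale_mult_right distrib_left power_int_add mult.commute)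
  moreover have "x * y = (\<Sum>i\<in>?S. \<Sum>j\<in>?T. ?x i * ?y j)"
    using sum_hcomponent[OF finite_hcomponent_support order_refl, of x]
      sum_hcomponent[OF finite_hcomponent_support order_refl, of y]
    by (simp flip: sum_product)
  ultimately have "koszul_sign scale gr d (x * y)
      = (\<Sum>i\<in>?S. \<Sum>j\<in>?T. scale ((-1) powi (d * i)) (?x i) * scale ((-1) powi (d * j)) (?y j))"
    by (simp add: koszul_sign_sum)
  then show ?thesis
    by (simp add: koszul_sign_def sum_product)
qed

lemma koszul_sign_degree_0 [simp]: "koszul_sign scale gr 0 x = x"
  using sum_hcomponent[OF finite_hcomponent_support order_refl, of x]
  by (simp add: koszul_sign_def)

lemma m_map_2_apply:
  "app (m_map scale gr \<Delta> 2) [a, b] = \<Delta> (a * b) - \<Delta> a * b - koszul_sign scale gr 1 a * \<Delta> b"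
  by (simp add: m_map_def compose_def op_map_def gam_def id_map_def numeral_2_eq_2)

lemma m_map_3_apply:
  "app (m_map scale gr \<Delta> 3) [a, b, c]
    = \<Delta> (a * b * c) - \<Delta> (a * b) * c - koszul_sign scale gr 1 a * \<Delta> (b * c)
      + koszul_sign scale gr 1 a * \<Delta> b * c"
  by (simp add: m_map_def compose_def op_map_def gam_def id_map_def numeral_3_eq_3 numeral_2_eq_2
      mult.assoc)

lemma m_map_2_product_left:
  "app (m_map scale gr \<Delta> 2) [a * b, c]
    = koszul_sign scale gr 1 a * app (m_map scale gr \<Delta> 2) [b, c]
      + app (m_map scale gr \<Delta> 3) [a, b, c]"
  by (simp add: m_map_2_apply m_map_3_apply koszul_sign_mult algebra_simps)

lemma m_map_2_product_right:
  "app (m_map scale gr \<Delta> 2) [a, b * c]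
    = app (m_map scale gr \<Delta> 2) [a, b] * c + app (m_map scale gr \<Delta> 3) [a, b, c]"
  by (simp add: m_map_2_apply m_map_3_apply algebra_simps)

end

lemma arity_deg_m_map_2: "arity (m_map scale gr \<Delta> 2) = 2" "deg (m_map scale gr \<Delta> 2) = 1"
  by (simp_all add: m_map_def Let_def)

theorem theorem3:
  fixes scale :: "'k::field_char_0 \<Rightarrow> 'a::ring \<Rightarrow> 'a"
    and gr :: "int \<Rightarrow> 'a set"
    and \<Delta> :: "'a \<Rightarrow> 'a"
  assumes "graded_algebra scale gr"
    and "Vector_Spaces.linear scale scale \<Delta>"
    and "\<And>i x. x \<in> gr i \<Longrightarrow> \<Delta> x \<in> gr (i + 1)"
    and "\<And>x. \<Delta> (\<Delta> x) = 0"
    and "associative_order scale gr \<Delta> 2"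
  shows "(\<forall>a b c. app (compose scale gr (gam 2) [id_map, m_map scale gr \<Delta> 2]) [a, b, c]
                = app (compose scale gr (m_map scale gr \<Delta> 2) [gam 2, id_map]) [a, b, c])
       \<and> (\<forall>a b c. app (compose scale gr (gam 2) [m_map scale gr \<Delta> 2, id_map]) [a, b, c]
                = app (compose scale gr (m_map scale gr \<Delta> 2) [id_map, gam 2]) [a, b, c])"
proof -
  interpret graded_algebra scale gr by fact
  have m3: "app (m_map scale gr \<Delta> 3) [a, b, c] = 0" for a b c
    using \<open>associative_order scale gr \<Delta> 2\<close> by (simp add: associative_order_def)
  have "app (compose scale gr (gam 2) [id_map, m_map scale gr \<Delta> 2]) [a, b, c]
      = koszul_sign scale gr 1 a * app (m_map scale gr \<Delta> 2) [b, c]"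
    and "app (compose scale gr (m_map scale gr \<Delta> 2) [gam 2, id_map]) [a, b, c]
      = app (m_map scale gr \<Delta> 2) [a * b, c]"
    and "app (compose scale gr (gam 2) [m_map scale gr \<Delta> 2, id_map]) [a, b, c]
      = app (m_map scale gr \<Delta> 2) [a, b] * c"
    and "app (compose scale gr (m_map scale gr \<Delta> 2) [id_map, gam 2]) [a, b, c]
      = app (m_map scale gr \<Delta> 2) [a, b * c]" for a b c
    by (simp_all add: compose_def gam_def id_map_def arity_deg_m_map_2)
  then show ?thesis
    by (simp add: m_map_2_product_left m_map_2_product_right m3)
qed

end
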